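(* Let $A\subseteq \mathbb{R}^m$, let $a\in A$ and let $V\subseteq \mathbb{R}^m$ be a linear subspace. Let $L\in \mathcal{L}(V,\mathbb{R}^n)$ be a tangential derivative of $f\colon A \to \mathbb{R}^n$ at $a$ with respect to $V$, and let $K\in \mathcal{L}(L[V], \mathbb{R}^p)$ be a tangential derivative of $g\colon f(A) \to \mathbb{R}^p$ at $f(a)$ with respect to $L[V]$. If $L$ is injective, then $K \circ L\in \mathcal{L}(V,\mathbb{R}^p)$ is a tangential derivative of $g\circ f$ at $a$ with respect to $V$.
   Context: $\mathcal{L}(V,\mathbb{R}^n)$ is the space of linear maps from $V$ to $\mathbb{R}^n$, and $L[V]$ is the image of $V$ under $L$. Tangential derivative: let $A\subseteq\mathbb{R}^m$, $a\in A$, $f\colon A\to\mathbb{R}^n$, and let $V\subseteq\mathbb{R}^m$ be a linear subspace. A linear map $L\in\mathcal{L}(V,\mathbb{R}^n)$ is a tangential derivative of $f$ at $a$ with respect to $V$ if for every $\varepsilon>0$ there exist $\delta>0$ and $\theta>0$ such that if $x\in A$, $v\in V$, $\lVert x-a\rVert\le\delta$ and $\lVert x-a-v\rVert\le\theta\lVert x-a\rVert$, then $\lVert f(x)-f(a)-L[v]\rVert\le\varepsilon\lVert x-a\rVert$. (The same definition is applied to $g$ with domain $f(A)\subseteq\mathbb{R}^n$, point $f(a)$ and subspace $L[V]$.) *)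

theory Defs
  imports "HOL-Analysis.Analysis"
begin

text \<open>
  Partially defined maps are total functions of which only the values on the intended domain
  matter: \<open>linear_map_on V L\<close> says that the restriction of \<open>L\<close> to the linear subspace \<open>V\<close> is a
  linear map on \<open>V\<close>, and both definitions below are insensitive to the values of \<open>L\<close> outside \<open>V\<close>
  and of \<open>f\<close> outside \<open>A\<close> (given \<open>a \<in> A\<close>).
\<close>

definition linear_map_on ::
  "'a::real_vector set \<Rightarrow> ('a \<Rightarrow> 'b::real_vector) \<Rightarrow> bool" where
  "linear_map_on V L \<longleftrightarrow>
     (\<forall>u\<in>V. \<forall>v\<in>V. L (u + v) = L u + L v) \<and> (\<forall>c. \<forall>v\<in>V. L (c *\<^sub>R v) = c *\<^sub>R L v)"

definition tangential_derivative ::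
  "('a::real_normed_vector \<Rightarrow> 'b::real_normed_vector) \<Rightarrow> 'a set \<Rightarrow> 'a \<Rightarrow> 'a set \<Rightarrow> ('a \<Rightarrow> 'b) \<Rightarrow> bool"
where
  "tangential_derivative f A a V L \<longleftrightarrow>
     linear_map_on V L \<and>
     (\<forall>\<epsilon>>0. \<exists>\<delta>>0. \<exists>\<theta>>0. \<forall>x\<in>A. \<forall>v\<in>V.
        norm (x - a) \<le> \<delta> \<longrightarrow> norm (x - a - v) \<le> \<theta> * norm (x - a) \<longrightarrow>
        norm (f x - f a - L v) \<le> \<epsilon> * norm (x - a))"

end

theory Submission
  imports Defs
begin

text \<open>
  On the finite-dimensional subspace \<open>V\<close> the injective map \<open>L\<close> satisfies \<open>c \<parallel>v\<parallel> \<le> \<parallel>L v\<parallel> \<le> C \<parallel>v\<parallel>\<close> with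
  \<open>c > 0\<close>. Hence \<open>\<parallel>f x - f a\<parallel>\<close> is comparable to \<open>\<parallel>x - a\<parallel>\<close> for \<open>x\<close> near \<open>a\<close> in a narrow cone around
  \<open>a + V\<close>, and \<open>f\<close> sends such \<open>x\<close> into a narrow cone around \<open>f a + L[V]\<close>, where the derivative of \<open>g\<close>
  applies. The lower bound is what makes the image cone narrow relative to \<open>\<parallel>f x - f a\<parallel>\<close>.
\<close>

lemma tangential_derivativeE:
  assumes "tangential_derivative f A a V L" and "\<epsilon> > 0"
  obtains \<delta> \<theta> where "\<delta> > 0" "\<theta> > 0"
    "\<And>x v. x \<in> A \<Longrightarrow> v \<in> V \<Longrightarrow> norm (x - a) \<le> \<delta> \<Longrightarrow> norm (x - a - v) \<le> \<theta> * norm (x - a) \<Longrightarrow>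
      norm (f x - f a - L v) \<le> \<epsilon> * norm (x - a)"
proof -
  have "\<exists>\<delta>>0. \<exists>\<theta>>0. \<forall>x\<in>A. \<forall>v\<in>V.
      norm (x - a) \<le> \<delta> \<longrightarrow> norm (x - a - v) \<le> \<theta> * norm (x - a) \<longrightarrow>
      norm (f x - f a - L v) \<le> \<epsilon> * norm (x - a)"
    using assms by (simp add: tangential_derivative_def)
  then obtain \<delta> \<theta> where "\<delta> > 0" "\<theta> > 0"
    "\<forall>x\<in>A. \<forall>v\<in>V. norm (x - a) \<le> \<delta> \<longrightarrow> norm (x - a - v) \<le> \<theta> * norm (x - a) \<longrightarrow>
      norm (f x - f a - L v) \<le> \<epsilon> * norm (x - a)"
    by (elim exE conjE)
  then show thesis
    by (intro that[of \<delta> \<theta>]) auto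
qed

text \<open>\<open>L\<close> is linear only on \<open>V\<close>, while results on bounded linear
  maps need a map on the whole space. Extend linearly from a basis of \<open>V\<close>: the points
  of \<open>V\<close> where both maps agree form a subspace containing the basis, hence all of
  \<open>V\<close>.\<close>

lemma linear_map_on_extend:
  fixes L :: "'a::real_vector \<Rightarrow> 'b::real_vector"
  assumes V: "subspace V" and L: "linear_map_on V L"
  obtains T where "linear T" "\<And>v. v \<in> V \<Longrightarrow> T v = L v"
proof -
  obtain B where B: "B \<subseteq> V" "independent B" "V \<subseteq> span B"
    using maximal_independent_subset by metis
  obtain T where T: "linear T" "\<forall>x\<in>B. T x = L x"
    using linear_independent_extend[OF B(2)] by metis
  have L_add: "L (u + v) = L u + L v" if "u \<in> V" "v \<in> V" for u v
    using L that by (auto simp: linear_map_on_def)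
  have L_scale: "L (c *\<^sub>R v) = c *\<^sub>R L v" if "v \<in> V" for c v
    using L that by (auto simp: linear_map_on_def)
  have "L 0 = 0"
    using L_scale[OF subspace_0[OF V], of 0] by simp
  then have "subspace {x \<in> V. T x = L x}"
    using V T(1) by (auto simp: subspace_def linear_0 linear_add linear_scale L_add L_scale)
  moreover have "B \<subseteq> {x \<in> V. T x = L x}"
    using B(1) T(2) by auto
  ultimately have "span B \<subseteq> {x \<in> V. T x = L x}"
    by (rule span_minimal[rotated])
  then show thesis
    using B(3) T(1) by (intro that[of T]) auto
qed

text \<open>The lower bound comes from compactness: the norm of the image is continuous and, by
  injectivity, positive on the unit sphere of \<open>V\<close>, so it has a positive minimum there.
  The upper bound is boundedness of the linear extension.\<close>

lemma inj_linear_map_on_bounds: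
  fixes L :: "'a::euclidean_space \<Rightarrow> 'b::euclidean_space"
  assumes V: "subspace V" and L: "linear_map_on V L" and inj: "inj_on L V"
  obtains c C where "c > 0" "C > 0"
    "\<And>v. v \<in> V \<Longrightarrow> c * norm v \<le> norm (L v)" "\<And>v. v \<in> V \<Longrightarrow> norm (L v) \<le> C * norm v"
proof -
  obtain T where T: "linear T" "\<And>v. v \<in> V \<Longrightarrow> T v = L v"
    using linear_map_on_extend[OF V L] by metis
  have bl: "bounded_linear T"
    using T(1) by (simp add: linear_conv_bounded_linear)
  \<comment> \<open>Injectivity is recast as a trivial kernel on \<open>V\<close>; \<open>T\<close>
    itself may fail to be injective outside \<open>V\<close>.\<close>
  have "v = 0" if "v \<in> V" "T v = 0" for v
    using inj that T subspace_0[OF V] by (metis inj_onD linear_0)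
  then obtain c where c: "c > 0" "\<forall>v\<in>V. norm (T v) \<ge> c * norm v"
    using injective_imp_isometric[OF closed_subspace[OF V] V bl] by blast
  obtain C where C: "C > 0" "\<And>v. norm (T v) \<le> norm v * C"
    using bounded_linear.pos_bounded[OF bl] by blast
  show thesis
  proof (rule that[OF c(1) C(1)])
    show "c * norm v \<le> norm (L v)" if "v \<in> V" for v
      using c(2) T(2) that by auto
    show "norm (L v) \<le> C * norm v" if "v \<in> V" for v
      using C(2)[of v] T(2) that by (simp add: mult.commute)
  qed
qed

lemma tangential_derivative_compose:
  fixes f :: "'a::euclidean_space \<Rightarrow> 'b::euclidean_space" and g :: "'b \<Rightarrow> 'c::real_normed_vector"
  assumes V: "subspace V"
    and f: "tangential_derivative f A a V L"
    and g: "tangential_derivative g (f ` A) (f a) (L ` V) K"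
    and inj: "inj_on L V"
  shows "tangential_derivative (g \<circ> f) A a V (K \<circ> L)"
proof -
  have linL: "linear_map_on V L" and linK: "linear_map_on (L ` V) K"
    using f g by (auto simp: tangential_derivative_def)
  have lin: "linear_map_on V (K \<circ> L)"
    using linL linK by (auto simp: linear_map_on_def)
  obtain c C where c: "c > 0" and C: "C > 0"
    and lower: "\<And>v. v \<in> V \<Longrightarrow> c * norm v \<le> norm (L v)"
    and upper: "\<And>v. v \<in> V \<Longrightarrow> norm (L v) \<le> C * norm v"
    using inj_linear_map_on_bounds[OF V linL inj] by metis
  \<comment> \<open>\<open>M\<close> will be a Lipschitz constant of \<open>f\<close> at
    \<open>a\<close> within the cone: \<open>3 / 2 * C\<close> bounds the contribution of
    \<open>L v\<close>, and \<open>c / 4\<close> that of the error.\<close>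
  define M where "M = 3 / 2 * C + c / 4"
  have M: "M > 0"
    using c C by (simp add: M_def)
  have "\<exists>\<delta>>0. \<exists>\<theta>>0. \<forall>x\<in>A. \<forall>v\<in>V.
      norm (x - a) \<le> \<delta> \<longrightarrow> norm (x - a - v) \<le> \<theta> * norm (x - a) \<longrightarrow>
      norm ((g \<circ> f) x - (g \<circ> f) a - (K \<circ> L) v) \<le> \<epsilon> * norm (x - a)"
    if "\<epsilon> > 0" for \<epsilon>
  proof -
    \<comment> \<open>Dividing by \<open>M\<close> compensates for the later estimate of
      \<open>norm (f x - f a)\<close> by \<open>M * norm (x - a)\<close>.\<close>
    have "\<epsilon> / M > 0"
      using that M by simp
    from tangential_derivativeE[OF g this] obtain \<eta> \<kappa> where \<eta>: "\<eta> > 0" and \<kappa>: "\<kappa> > 0"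
      and g': "\<And>y w. y \<in> f ` A \<Longrightarrow> w \<in> L ` V \<Longrightarrow> norm (y - f a) \<le> \<eta> \<Longrightarrow>
        norm (y - f a - w) \<le> \<kappa> * norm (y - f a) \<Longrightarrow>
        norm (g y - g (f a) - K w) \<le> \<epsilon> / M * norm (y - f a)"
      by blast
    \<comment> \<open>The first entry keeps half of the lower bound
      \<open>c / 2 * norm (x - a)\<close> on \<open>norm (L v)\<close>; the second puts
      \<open>f x\<close> into the \<open>\<kappa>\<close>-cone required by \<open>g\<close>.\<close>
    define \<epsilon>' where "\<epsilon>' = min (c / 4) (\<kappa> * (c / 4))"
    have "\<epsilon>' > 0"
      using c \<kappa> by (simp add: \<epsilon>'_def)
    from tangential_derivativeE[OF f this] obtain \<delta> \<theta> where \<delta>: "\<delta> > 0" and \<theta>: "\<theta> > 0"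
      and f': "\<And>x v. x \<in> A \<Longrightarrow> v \<in> V \<Longrightarrow> norm (x - a) \<le> \<delta> \<Longrightarrow>
        norm (x - a - v) \<le> \<theta> * norm (x - a) \<Longrightarrow>
        norm (f x - f a - L v) \<le> \<epsilon>' * norm (x - a)"
      by blast
    \<comment> \<open>The radius \<open>\<eta> / M\<close> keeps \<open>f x\<close> within
      \<open>\<eta>\<close> of \<open>f a\<close>; the aperture \<open>1 / 2\<close> makes
      \<open>norm v\<close> comparable to \<open>norm (x - a)\<close>.\<close>
    have "norm (g (f x) - g (f a) - K (L v)) \<le> \<epsilon> * norm (x - a)"
      if x: "x \<in> A" and v: "v \<in> V" and near: "norm (x - a) \<le> min \<delta> (\<eta> / M)"
        and cone: "norm (x - a - v) \<le> min \<theta> (1 / 2) * norm (x - a)" for x v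
    proof -
      let ?r = "norm (x - a)" and ?s = "norm (f x - f a)"
      have "norm (x - a - v) \<le> \<theta> * ?r"
        by (rule order_trans[OF cone], intro mult_right_mono) simp_all
      then have err: "norm (f x - f a - L v) \<le> \<epsilon>' * ?r"
        using near by (intro f' x v) simp_all
      have "norm (x - a - v) \<le> 1 / 2 * ?r"
        by (rule order_trans[OF cone], intro mult_right_mono) simp_all
      then have v_cone: "norm (x - a - v) \<le> ?r / 2"
        by linarith
      have v_bounds: "?r / 2 \<le> norm v" "norm v \<le> 3 / 2 * ?r"
        using v_cone norm_triangle_ineq2[of "x - a" v] norm_triangle_ineq3[of "x - a" v] by auto
      have Lv_lower: "c * (?r / 2) \<le> norm (L v)"
        using mult_left_mono[OF v_bounds(1), of c] lower[OF v] c by linarith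
      have Lv_upper: "norm (L v) \<le> C * (3 / 2 * ?r)"
        using mult_left_mono[OF v_bounds(2), of C] upper[OF v] C by linarith
      have "\<epsilon>' * ?r \<le> c / 4 * ?r"
        by (intro mult_right_mono) (auto simp: \<epsilon>'_def)
      with err have err_c: "norm (f x - f a - L v) \<le> c / 4 * ?r"
        by linarith
      have s_lower: "c / 4 * ?r \<le> ?s"
        using err_c Lv_lower norm_triangle_ineq3[of "f x - f a" "L v"] by (simp add: abs_le_iff)
      have s_upper: "?s \<le> M * ?r"
        using err_c Lv_upper norm_triangle_ineq2[of "f x - f a" "L v"]
        by (simp add: M_def algebra_simps)
      have "M * ?r \<le> \<eta>"
        using near M by (simp add: field_simps)
      then have "?s \<le> \<eta>"
        using s_upper by linarith
      \<comment> \<open>The error is small relative to \<open>?r\<close>; \<open>s_lower\<close>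
        makes it small relative to \<open>?s\<close>.\<close>
      moreover have "norm (f x - f a - L v) \<le> \<kappa> * ?s"
      proof -
        have "\<epsilon>' * ?r \<le> \<kappa> * (c / 4) * ?r"
          by (intro mult_right_mono) (auto simp: \<epsilon>'_def)
        also have "\<dots> \<le> \<kappa> * ?s"
          using mult_left_mono[OF s_lower, of \<kappa>] \<kappa> by (simp add: mult.assoc)
        finally show ?thesis
          using err by linarith
      qed
      ultimately have "norm (g (f x) - g (f a) - K (L v)) \<le> \<epsilon> / M * ?s"
        using x v by (intro g') auto
      also have "\<dots> \<le> \<epsilon> / M * (M * ?r)"
        using \<open>\<epsilon> / M > 0\<close> by (intro mult_left_mono s_upper) auto
      also have "\<dots> = \<epsilon> * ?r"
        using M by simp
      finally show ?thesis .
    qed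
    moreover have "min \<delta> (\<eta> / M) > 0" "min \<theta> (1 / 2) > 0"
      using \<delta> \<theta> \<eta> M by auto
    ultimately show ?thesis
      unfolding o_def
      by (intro exI[of _ "min \<delta> (\<eta> / M)"] exI[of _ "min \<theta> (1 / 2)"] conjI ballI impI)
  qed
  with lin show ?thesis
    by (auto simp: tangential_derivative_def)
qed

theorem corollary3p3:
  fixes A :: "(real ^ 'm) set" and a :: "real ^ 'm" and V :: "(real ^ 'm) set"
    and f :: "real ^ 'm \<Rightarrow> real ^ 'n" and g :: "real ^ 'n \<Rightarrow> real ^ 'p"
    and L :: "real ^ 'm \<Rightarrow> real ^ 'n" and K :: "real ^ 'n \<Rightarrow> real ^ 'p"
  assumes "a \<in> A"
    and "subspace V"
    and "tangential_derivative f A a V L"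
    and "tangential_derivative g (f ` A) (f a) (L ` V) K"
    and "inj_on L V"
  shows "tangential_derivative (g \<circ> f) A a V (K \<circ> L)"
  using assms(2-5) by (rule tangential_derivative_compose)

end
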